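(* There exists no $3$-generated primitive axial algebra of Monster type over a field of characteristic $0$ of shape $3\mathrm{C}\,2\mathrm{A}$ or $5\mathrm{A}\,2\mathrm{A}$. That is, there is no such algebra $A=\langle\!\langle a,b,c\rangle\!\rangle$ generated by axes $a,b,c$ with $\langle\!\langle a,b\rangle\!\rangle\cong\langle\!\langle a,c\rangle\!\rangle\cong2\mathrm{A}$ and $\langle\!\langle b,c\rangle\!\rangle$ isomorphic to $3\mathrm{C}$ or to $5\mathrm{A}$.
   Context: Let $\mathbb{F}$ be a field of characteristic $0$. A (primitive) axial algebra of Monster type is a pair $(A,X)$, where $A$ is a commutative, not necessarily associative $\mathbb{F}$-algebra generated by a set $X$ of non-zero idempotents (axes) such that for every $a\in X$: $\mathrm{ad}_a\colon v\mapsto av$ is semisimple with all eigenvalues in $\{1,0,\frac14,\frac1{32}\}$; $A_1(a)=\langle a\rangle$ is $1$-dimensional, where $A_\lambda(a)$ is the $\lambda$-eigenspace of $\mathrm{ad}_a$; and $A_\lambda(a)A_\mu(a)\subseteq\bigoplus_{\nu\in\lambda\star\mu}A_\nu(a)$, where $\star$ is the symmetric Monster fusion law $1\star1=\{1\}$, $1\star0=\emptyset$, $0\star0=\{0\}$, $1\star\frac14=0\star\frac14=\{\frac14\}$, $1\star\frac1{32}=0\star\frac1{32}=\frac14\star\frac1{32}=\{\frac1{32}\}$, $\frac14\star\frac14=\{1,0\}$, $\frac1{32}\star\frac1{32}=\{1,0,\frac14\}$. The Miyamoto involution $\tau_a$ is the automorphism of $A$ that is the identity on $A_1(a)\oplus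 A_0(a)\oplus A_{1/4}(a)$ and $-1$ on $A_{1/32}(a)$ (possibly trivial). $\langle\!\langle Y\rangle\!\rangle$ denotes the subalgebra generated by $Y$. Norton-Sakuma algebras (generated by axes $a_0,a_1$; all $a_i$ are idempotents; $\langle\!\langle p,q\rangle\!\rangle\cong n\mathrm{L}$ means there is an isomorphism sending $p,q$ to $a_0,a_1$, with $a_{\epsilon+2k}=a_\epsilon^{\rho^k}$, $\epsilon\in\{0,1\}$, $\rho=\tau_p\tau_q$): - $2\mathrm{A}$: basis $a_0,a_1,a_\rho$ of idempotents; the product of two distinct basis elements is $\frac18$(their sum minus the third basis element). - $3\mathrm{C}$: basis $a_{-1},a_0,a_1$ (indices mod $3$); $a_ia_{i+1}=\frac1{2^6}(a_i+a_{i+1}-a_{i-1})$. - $5\mathrm{A}$: basis $a_{-2},\dots,a_2,w$ (indices mod $5$); $a_ia_{i+1}=\frac1{2^7}(3a_i+3a_{i+1}-a_{i+2}-a_{i-1}-a_{i-2})+w$, $a_ia_{i+2}=\frac1{2^7}(3a_i+3a_{i+2}-a_{i+1}-a_{i-1}-a_{i-2})-w$, $a_iw=\frac7{2^{12}}(a_{i+1}+a_{i-1}-a_{i+2}-a_{i-2})+\frac7{2^5}w$, $w^2=\frac{5^2\cdot7}{2^{19}}(a_{-2}+a_{-1}+a_0+a_1+a_2)$. *)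

theory Defs
  imports "HOL-Analysis.Finite_Cartesian_Product" "HOL-Analysis.Cartesian_Space"
    "HOL-Library.Numeral_Type"
begin

text \<open>
  The algebra \<open>A\<close> is the whole type \<open>'a\<close>, with the scalar action and the product as explicit
  parameters, so that no associativity or unit is imposed by a type class.
\<close>

locale comm_nonassoc_algebra = vector_space scale
  for scale :: "'f::field_char_0 \<Rightarrow> 'a::ab_group_add \<Rightarrow> 'a" +
  fixes mul :: "'a \<Rightarrow> 'a \<Rightarrow> 'a"
  assumes mul_commute: "mul x y = mul y x"
    and mul_add_left: "mul (x + y) z = mul x z + mul y z"
    and mul_scale_left: "mul (scale r x) y = scale r (mul x y)"


section \<open>Axes of Monster type\<close>

datatype monster_ev = Ev1 | Ev0 | Ev4 | Ev32

fun ev_val :: "monster_ev \<Rightarrow> 'f::field_char_0" where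
  "ev_val Ev1 = 1"
| "ev_val Ev0 = 0"
| "ev_val Ev4 = 1 / 4"
| "ev_val Ev32 = 1 / 32"

fun monster_fusion :: "monster_ev \<Rightarrow> monster_ev \<Rightarrow> monster_ev set" where
  "monster_fusion Ev1 Ev1 = {Ev1}"
| "monster_fusion Ev1 Ev0 = {}"
| "monster_fusion Ev1 Ev4 = {Ev4}"
| "monster_fusion Ev1 Ev32 = {Ev32}"
| "monster_fusion Ev0 Ev1 = {}"
| "monster_fusion Ev0 Ev0 = {Ev0}"
| "monster_fusion Ev0 Ev4 = {Ev4}"
| "monster_fusion Ev0 Ev32 = {Ev32}"
| "monster_fusion Ev4 Ev1 = {Ev4}"
| "monster_fusion Ev4 Ev0 = {Ev4}"
| "monster_fusion Ev4 Ev4 = {Ev1, Ev0}"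
| "monster_fusion Ev4 Ev32 = {Ev32}"
| "monster_fusion Ev32 Ev1 = {Ev32}"
| "monster_fusion Ev32 Ev0 = {Ev32}"
| "monster_fusion Ev32 Ev4 = {Ev32}"
| "monster_fusion Ev32 Ev32 = {Ev1, Ev0, Ev4}"

context comm_nonassoc_algebra
begin

definition subalgebra :: "'a set \<Rightarrow> bool" where
  "subalgebra S \<longleftrightarrow> subspace S \<and> (\<forall>x\<in>S. \<forall>y\<in>S. mul x y \<in> S)"

definition gen_subalgebra :: "'a set \<Rightarrow> 'a set" where
  "gen_subalgebra Y = subalgebra hull Y"

definition eigenspace :: "'f \<Rightarrow> 'a \<Rightarrow> 'a set" where
  "eigenspace l a = {v. mul a v = scale l v}"

definition monster_axis :: "'a \<Rightarrow> bool" where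
  "monster_axis a \<longleftrightarrow>
     a \<noteq> 0 \<and> mul a a = a \<and>
     span (\<Union>l. eigenspace l a) = UNIV \<and>
     (\<forall>l. eigenspace l a \<noteq> {0} \<longrightarrow> l \<in> range ev_val) \<and>
     eigenspace 1 a = span {a} \<and>
     (\<forall>l m. \<forall>x \<in> eigenspace (ev_val l) a. \<forall>y \<in> eigenspace (ev_val m) a.
        mul x y \<in> span (\<Union>n \<in> monster_fusion l m. eigenspace (ev_val n) a))"

definition algebra_automorphism :: "('a \<Rightarrow> 'a) \<Rightarrow> bool" where
  "algebra_automorphism g \<longleftrightarrow>
     Vector_Spaces.linear scale scale g \<and> bij g \<and> (\<forall>x y. g (mul x y) = mul (g x) (g y))"

definition miyamoto :: "'a \<Rightarrow> 'a \<Rightarrow> 'a" where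
  "miyamoto a = (THE t. algebra_automorphism t \<and>
     (\<forall>v \<in> span (eigenspace 1 a \<union> eigenspace 0 a \<union> eigenspace (1 / 4) a). t v = v) \<and>
     (\<forall>v \<in> eigenspace (1 / 32) a. t v = - v))"

text \<open>
  Automorphisms act on the right in the notation \<open>a\<^sup>\<rho>\<close>, so \<open>\<rho> = \<tau>\<^sub>p \<tau>\<^sub>q\<close> applies \<open>\<tau>\<^sub>p\<close> first.
  The other order would replace \<open>\<rho>\<close> by its inverse and turn \<open>a\<^bsub>i\<^esub> \<mapsto> a\<^bsub>i+2\<^esub>\<close> into \<open>a\<^bsub>i\<^esub> \<mapsto> a\<^bsub>i-2\<^esub>\<close>.
\<close>

definition rho :: "'a \<Rightarrow> 'a \<Rightarrow> 'a \<Rightarrow> 'a" where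
  "rho p q = miyamoto q \<circ> miyamoto p"

text \<open>
  The sequence \<open>a\<^bsub>\<epsilon>+2k\<^esub> = a\<^sub>\<epsilon>\<close> acted on by \<open>\<rho>\<^sup>k\<close>, with \<open>a\<^sub>0 = p\<close> and \<open>a\<^sub>1 = q\<close>;
  here \<open>\<epsilon> = i mod 2\<close> and \<open>k = i div 2\<close>.
\<close>

definition dihedral_seq :: "'a \<Rightarrow> 'a \<Rightarrow> int \<Rightarrow> 'a" where
  "dihedral_seq p q i =
     (let x = (if even i then p else q); k = i div 2
      in if 0 \<le> k then (rho p q ^^ nat k) x else (inv (rho p q) ^^ nat (- k)) x)"

end

locale monster_axial_algebra = comm_nonassoc_algebra scale mul
  for scale :: "'f::field_char_0 \<Rightarrow> 'a::ab_group_add \<Rightarrow> 'a"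
  and mul :: "'a \<Rightarrow> 'a \<Rightarrow> 'a" +
  fixes X :: "'a set"
  assumes generated: "gen_subalgebra X = UNIV"
    and axes: "x \<in> X \<Longrightarrow> monster_axis x"


section \<open>Norton-Sakuma algebras\<close>

text \<open>
  An algebra with basis indexed by \<open>'i\<close> lives on the coordinate space \<open>'f ^ 'i\<close>; it is given by
  the table \<open>t\<close> of the products of basis vectors.
\<close>

abbreviation bvec :: "'i::finite \<Rightarrow> 'f::field_char_0 ^ 'i" where
  "bvec i \<equiv> axis i 1"

definition table_mul ::
  "('i::finite \<Rightarrow> 'i \<Rightarrow> 'f::field_char_0 ^ 'i) \<Rightarrow> 'f ^ 'i \<Rightarrow> 'f ^ 'i \<Rightarrow> 'f ^ 'i" where
  "table_mul t x y = (\<Sum>i\<in>UNIV. \<Sum>j\<in>UNIV. (x $ i * y $ j) *s t i j)"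

text \<open>
  In \<open>2A\<close> the indices 0, 1, 2 stand for \<open>a\<^sub>0\<close>, \<open>a\<^sub>1\<close>, \<open>a\<^sub>\<rho>\<close>. In \<open>3C\<close> and \<open>5A\<close> index arithmetic takes
  place in the types of integers modulo 3 and 5; in \<open>5A\<close> the basis vector \<open>w\<close> has index \<open>None\<close>.
\<close>

definition table_2A :: "3 \<Rightarrow> 3 \<Rightarrow> 'f::field_char_0 ^ 3" where
  "table_2A i j =
     (if i = j then bvec i
      else (1 / 8) *s (bvec i + bvec j - (\<Sum>k \<in> UNIV - {i, j}. bvec k)))"

definition prod_3C :: "3 \<Rightarrow> 'f::field_char_0 ^ 3" where
  "prod_3C i = (1 / 2 ^ 6) *s (bvec i + bvec (i + 1) - bvec (i - 1))"

definition table_3C :: "3 \<Rightarrow> 3 \<Rightarrow> 'f::field_char_0 ^ 3" where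
  "table_3C i j =
     (if i = j then bvec i
      else if j = i + 1 then prod_3C i
      else prod_3C j)"

abbreviation a5 :: "5 \<Rightarrow> 'f::field_char_0 ^ (5 option)" where
  "a5 i \<equiv> bvec (Some i)"

abbreviation w5 :: "'f::field_char_0 ^ (5 option)" where
  "w5 \<equiv> bvec None"

definition prod1_5A :: "5 \<Rightarrow> 'f::field_char_0 ^ (5 option)" where
  "prod1_5A i =
     (1 / 2 ^ 7) *s (3 *s a5 i + 3 *s a5 (i + 1) - a5 (i + 2) - a5 (i - 1) - a5 (i - 2)) + w5"

definition prod2_5A :: "5 \<Rightarrow> 'f::field_char_0 ^ (5 option)" where
  "prod2_5A i =
     (1 / 2 ^ 7) *s (3 *s a5 i + 3 *s a5 (i + 2) - a5 (i + 1) - a5 (i - 1) - a5 (i - 2)) - w5"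

definition prodw_5A :: "5 \<Rightarrow> 'f::field_char_0 ^ (5 option)" where
  "prodw_5A i =
     (7 / 2 ^ 12) *s (a5 (i + 1) + a5 (i - 1) - a5 (i + 2) - a5 (i - 2)) + (7 / 2 ^ 5) *s w5"

fun table_5A :: "5 option \<Rightarrow> 5 option \<Rightarrow> 'f::field_char_0 ^ (5 option)" where
  "table_5A (Some i) (Some j) =
     (if i = j then a5 i
      else if j = i + 1 then prod1_5A i
      else if i = j + 1 then prod1_5A j
      else if j = i + 2 then prod2_5A i
      else prod2_5A j)"
| "table_5A (Some i) None = prodw_5A i"
| "table_5A None (Some i) = prodw_5A i"
| "table_5A None None = (5\<^sup>2 * 7 / 2 ^ 19) *s (\<Sum>i\<in>UNIV. a5 i)"

context comm_nonassoc_algebra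
begin

text \<open>
  An isomorphism from the algebra with table \<open>t\<close> onto the subalgebra generated by \<open>p\<close> and \<open>q\<close>.
  The function \<open>ix\<close> maps an integer \<open>i\<close> to the index of the basis vector called \<open>a\<^sub>i\<close>.
\<close>

definition sakuma_iso ::
  "('i::finite \<Rightarrow> 'i \<Rightarrow> 'f ^ 'i) \<Rightarrow> (int \<Rightarrow> 'i) \<Rightarrow> 'a \<Rightarrow> 'a \<Rightarrow> bool" where
  "sakuma_iso t ix p q \<longleftrightarrow>
     (\<exists>\<phi> :: 'f ^ 'i \<Rightarrow> 'a.
        Vector_Spaces.linear (*s) scale \<phi> \<and>
        bij_betw \<phi> UNIV (gen_subalgebra {p, q}) \<and>
        (\<forall>x y. \<phi> (table_mul t x y) = mul (\<phi> x) (\<phi> y)) \<and>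
        \<phi> (bvec (ix 0)) = p \<and> \<phi> (bvec (ix 1)) = q \<and>
        (\<forall>i. \<phi> (bvec (ix i)) = dihedral_seq p q i))"

definition iso_2A :: "'a \<Rightarrow> 'a \<Rightarrow> bool" where
  "iso_2A = sakuma_iso table_2A (\<lambda>i. if even i then 0 else 1)"

definition iso_3C :: "'a \<Rightarrow> 'a \<Rightarrow> bool" where
  "iso_3C = sakuma_iso table_3C of_int"

definition iso_5A :: "'a \<Rightarrow> 'a \<Rightarrow> bool" where
  "iso_5A = sakuma_iso table_5A (\<lambda>i. Some (of_int i))"

end

end

theory Submission imports Defs begin

text \<open>
  Both shapes fall to one argument. Since \<open>\<langle>\<langle>a, b\<rangle>\<rangle>\<close> and \<open>\<langle>\<langle>a, c\<rangle>\<rangle>\<close> are of type \<open>2A\<close>, the generators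
  \<open>a, b, c\<close> have no component in \<open>A\<^bsub>1/32\<^esub>(a)\<close>, so by the fusion law \<open>A\<^bsub>1/32\<^esub>(a) = 0\<close>. The fusion law is
  then graded a second time: the map \<open>\<sigma>\<close> that is \<open>1\<close> on \<open>A\<^sub>1(a) \<oplus> A\<^sub>0(a)\<close> and \<open>-1\<close> on \<open>A\<^bsub>1/4\<^esub>(a)\<close> is
  an automorphism, and it exchanges \<open>b\<close> with the third axis of \<open>\<langle>\<langle>a, b\<rangle>\<rangle>\<close>, and \<open>c\<close> likewise.

  The axes of \<open>\<langle>\<langle>b, c\<rangle>\<rangle>\<close> form a sequence \<open>x\<^sub>i\<close> of odd period \<open>n\<close> (3 or 5). Each \<open>x\<^sub>i\<close> is the image
  of \<open>b\<close> or \<open>c\<close> under a power of \<open>\<rho>\<close>, which fixes \<open>a\<close>; so each \<open>x\<^sub>i\<close> is an axis with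
  \<open>a x\<^sub>i = (a + x\<^sub>i - \<sigma> x\<^sub>i)/8\<close>. Two facts about \<open>3C\<close> and \<open>5A\<close> suffice: \<open>x\<^bsub>i+j\<^esub> - x\<^bsub>i-j\<^esub>\<close> is a
  \<open>1/32\<close>-eigenvector of \<open>x\<^sub>i\<close>, and \<open>x\<^sub>i S = \<nu> x\<^sub>i\<close> for a scalar \<open>\<nu>\<close>, where \<open>S = x\<^sub>0 + \<dots> + x\<^bsub>n-1\<^esub>\<close>.

  Put \<open>z\<^sub>i = x\<^sub>i - \<sigma> x\<^sub>i\<close> and \<open>s\<^bsub>ik\<^esub> = (\<sigma> x\<^sub>i) x\<^sub>k - x\<^sub>i (\<sigma> x\<^sub>k)\<close>, which is antisymmetric. The
  \<open>1/32\<close>-eigenvectors determine all \<open>s\<^bsub>ik\<^esub>\<close> because the period is odd: \<open>s\<^bsub>ik\<^esub> = (z\<^sub>k - z\<^sub>i)/32\<close>.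
  The \<open>0\<close>-eigenvector \<open>S - \<nu> x\<^sub>i\<close>, multiplied by the \<open>0\<close>- and \<open>1/4\<close>-eigenvectors of \<open>x\<^sub>i\<close> in
  \<open>\<langle>\<langle>a, x\<^sub>i\<rangle>\<rangle>\<close>, gives \<open>\<Sum>\<^sub>k s\<^bsub>ik\<^esub> = (\<Sum>\<^sub>k (z\<^sub>k - z\<^sub>i))/8\<close>. As \<open>1/8 \<noteq> 1/32\<close>, all \<open>z\<^sub>i\<close> coincide and
  all \<open>s\<^bsub>ik\<^esub>\<close> vanish. Hence \<open>b z\<^sub>1 = c z\<^sub>0\<close>, that is \<open>b z\<^sub>0 = c z\<^sub>1\<close>. But \<open>b z\<^sub>0 = (6 b + z\<^sub>0 + a)/8\<close> and
  \<open>c z\<^sub>1 = (6 c + z\<^sub>1 + a)/8\<close>, whence \<open>b = c\<close>, which is absurd. This is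
  \<open>odd_dihedral_collapse\<close>; \<open>no_odd_sakuma\<close> feeds a multiplication table into it.
\<close>

section \<open>The tables of the Norton-Sakuma algebras\<close>

lemma table_mul_bvec: "table_mul t (bvec i) (bvec j) = t i j"
proof -
  have "table_mul t (bvec i) (bvec j)
      = (\<Sum>k\<in>UNIV. \<Sum>l\<in>UNIV. if l = j then if k = i then t k l else 0 else 0)"
    unfolding table_mul_def axis_def by (intro sum.cong refl) auto
  then show ?thesis by simp
qed

lemma all_3: "(\<forall>i::3. P i) \<longleftrightarrow> P 0 \<and> P 1 \<and> P 2"
proof -
  have "(3 :: 3) = 0" by simp
  then show ?thesis unfolding forall_3 by metis
qed

lemma all_5: "(\<forall>i::5. P i) \<longleftrightarrow> P 0 \<and> P 1 \<and> P 2 \<and> P 3 \<and> P 4"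
proof -
  have "i = 0 \<or> i = 1 \<or> i = 2 \<or> i = 3 \<or> i = 4" for i :: 5
  proof (cases i)
    case (of_int z)
    then have "z = 0 \<or> z = 1 \<or> z = 2 \<or> z = 3 \<or> z = 4" by auto
    then show ?thesis using of_int by auto
  qed
  then show ?thesis by metis
qed

lemma all_option: "(\<forall>k. P k) \<longleftrightarrow> P None \<and> (\<forall>i. P (Some i))"
  by (metis not_None_eq)

text \<open>
  Two basis axes that the reflection at \<open>a\<^sub>i\<close> exchanges differ by a \<open>1/32\<close>-eigenvector of \<open>a\<^sub>i\<close>. Moreover
  \<open>a\<^sub>i\<close> maps the sum of all basis axes to a multiple of itself; in \<open>5A\<close> this holds because the products with
  \<open>a\<^bsub>i\<plusminus>1\<^esub>\<close> contain \<open>w\<close> and those with \<open>a\<^bsub>i\<plusminus>2\<^esub>\<close> contain \<open>-w\<close>.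
\<close>

lemma table_3C_reflection:
  "\<forall>i j. table_3C i (i + j) - table_3C i (i - j)
     = (1 / 32 :: 'f::field_char_0) *s (bvec (i + j) - bvec (i - j))"
  unfolding all_3 vec_eq_iff table_3C_def prod_3C_def
  by (simp add: axis_def)

lemma table_3C_sum:
  "\<forall>i. table_3C i i + table_3C i (i + 1) + table_3C i (i + 2) = (33 / 32 :: 'f::field_char_0) *s bvec i"
  unfolding all_3 vec_eq_iff table_3C_def prod_3C_def
  by (simp add: axis_def)

lemma table_5A_reflection:
  "\<forall>i j. table_5A (Some i) (Some (i + j)) - table_5A (Some i) (Some (i - j))
     = (1 / 32 :: 'f::field_char_0) *s (a5 (i + j) - a5 (i - j))"
  unfolding all_5 all_option vec_eq_iff table_5A.simps prod1_5A_def prod2_5A_def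
  by (simp add: axis_def)

lemma table_5A_sum:
  "\<forall>i. table_5A (Some i) (Some i) + table_5A (Some i) (Some (i + 1)) + table_5A (Some i) (Some (i + 2))
      + table_5A (Some i) (Some (i + 3)) + table_5A (Some i) (Some (i + 4))
     = (35 / 32 :: 'f::field_char_0) *s a5 i"
  unfolding all_5 all_option vec_eq_iff table_5A.simps prod1_5A_def prod2_5A_def
  by (simp add: axis_def)

section \<open>Bilinearity, and linear identities by functionals\<close>

lemma ev_val_inj: "(ev_val l :: 'f::field_char_0) = ev_val m \<longleftrightarrow> l = m"
  by (cases l; cases m) auto

context comm_nonassoc_algebra
begin

lemma mul_add_right: "mul x (y + z) = mul x y + mul x z"
  by (metis mul_add_left mul_commute)

lemma mul_scale_right: "mul x (scale r y) = scale r (mul x y)"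
  by (metis mul_scale_left mul_commute)

lemma mul_0_right [simp]: "mul x 0 = 0"
  using mul_scale_right[of x 0 0] by simp

lemma mul_0_left [simp]: "mul 0 x = 0"
  by (metis mul_0_right mul_commute)

lemma mul_minus_right: "mul x (- y) = - mul x y"
  using mul_scale_right[of x "-1" y] by simp

lemma mul_minus_left: "mul (- y) x = - mul y x"
  by (metis mul_minus_right mul_commute)

lemma mul_diff_right: "mul x (y - z) = mul x y - mul x z"
  using mul_add_right[of x y "- z"] by (simp add: mul_minus_right)

lemma mul_diff_left: "mul (y - z) x = mul y x - mul z x"
  by (metis mul_diff_right mul_commute)

lemma mul_sum_right: "mul x (sum f I) = (\<Sum>i\<in>I. mul x (f i))"
  by (induction I rule: infinite_finite_induct) (simp_all add: mul_add_right)

lemmas mul_simps = mul_add_left mul_add_right mul_scale_left mul_scale_right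
  mul_minus_left mul_minus_right mul_diff_left mul_diff_right

text \<open>
  Functionals turn an identity between vectors into one between scalars, where the arithmetic of
  fields decides it.
\<close>

lemma eq_by_functionals:
  assumes "\<And>f. Vector_Spaces.linear scale (*) f \<Longrightarrow> f x = f y"
  shows "x = y"
proof (rule ccontr)
  assume "x \<noteq> y"
  interpret P: vector_space_pair scale "(*) :: 'f \<Rightarrow> 'f \<Rightarrow> 'f"
    by (unfold_locales) (simp_all add: algebra_simps)
  have "independent {x - y}"
    using \<open>x \<noteq> y\<close> by (simp add: dependent_single)
  then obtain f where f: "Vector_Spaces.linear scale (*) f" "f (x - y) = 1"
    using P.linear_independent_extend[of "{x - y}" "\<lambda>_. 1"] by auto
  interpret f: Vector_Spaces.linear scale "(*)" f by fact
  show False using f(2) assms[OF f(1)] by (simp add: f.diff)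
qed

lemma functional_simps:
  assumes "Vector_Spaces.linear scale (*) f"
  shows "f (x + y) = f x + f y" "f (x - y) = f x - f y" "f (scale r x) = r * f x"
    "f (- x) = - f x" "f 0 = 0"
proof -
  interpret f: Vector_Spaces.linear scale "(*)" f by fact
  show "f (x + y) = f x + f y" "f (x - y) = f x - f y" "f (scale r x) = r * f x"
    "f (- x) = - f x" "f 0 = 0"
    by (simp_all add: f.add f.diff f.scale f.neg f.zero)
qed

section \<open>Eigenspaces and the fusion law\<close>

lemma subspace_eigenspace: "subspace (eigenspace l a)"
  unfolding subspace_def eigenspace_def
  by (auto simp: mul_add_right mul_scale_right scale_right_distrib scale_left_commute)

lemma mul_span:
  assumes x: "x \<in> span S" and y: "y \<in> span T" and R: "subspace R"
    and ST: "\<And>x y. x \<in> S \<Longrightarrow> y \<in> T \<Longrightarrow> mul x y \<in> R"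
  shows "mul x y \<in> R"
proof -
  have T: "mul x y \<in> R" if "x \<in> S" for x
    using y
  proof (induction rule: span_induct_alt)
    case base then show ?case using R by (simp add: subspace_0)
  next
    case (step c u v)
    then show ?case using R ST that
      by (simp add: mul_add_right mul_scale_right subspace_add subspace_scale)
  qed
  show ?thesis using x
  proof (induction rule: span_induct_alt)
    case base then show ?case using R by (simp add: subspace_0)
  next
    case (step c u v)
    then show ?case using R T
      by (simp add: mul_add_left mul_scale_left subspace_add subspace_scale)
  qed
qed

text \<open>
  Eigenspaces are independent. In the step, \<open>ad\<^sub>a - m\<close> kills the \<open>m\<close>-component, keeps the span of the
  other eigenspaces, and multiplies \<open>v\<close> by \<open>l - m \<noteq> 0\<close>.
\<close>

lemma eigenspace_span_Int:
  assumes "finite M" "l \<notin> M" "v \<in> eigenspace l a" "v \<in> span (\<Union>m\<in>M. eigenspace m a)"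
  shows "v = 0"
  using assms
proof (induction M arbitrary: v rule: finite_induct)
  case empty then show ?case by simp
next
  case (insert m M)
  let ?S = "span (\<Union>m\<in>M. eigenspace m a)"
  have "v \<in> span (eigenspace m a \<union> (\<Union>m\<in>M. eigenspace m a))"
    using insert.prems by simp
  then obtain y w where yw: "v = y + w" "y \<in> eigenspace m a" "w \<in> ?S"
    unfolding span_Un using subspace_eigenspace[of m a] by (auto simp: span_eq_iff[THEN iffD2])
  have "mul a w \<in> ?S"
    using yw(3)
  proof (induction rule: span_induct_alt)
    case base then show ?case by (simp add: span_zero)
  next
    case (step c u w)
    then obtain k where "k \<in> M" "u \<in> eigenspace k a" by auto
    then have "mul a u \<in> ?S"
      using span_base[of u "\<Union>m\<in>M. eigenspace m a"] by (auto simp: eigenspace_def intro!: span_scale)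
    then show ?case using step by (simp add: mul_add_right mul_scale_right span_add span_scale)
  qed
  then have "mul a w - scale m w \<in> ?S" using yw(3) by (simp add: span_diff span_scale)
  also have "mul a w - scale m w = mul a v - scale m v"
    using yw by (simp add: eigenspace_def mul_add_right scale_right_distrib)
  also have "\<dots> = scale (l - m) v"
    using insert.prems by (simp add: eigenspace_def scale_left_diff_distrib)
  finally have "scale (l - m) v \<in> ?S" .
  moreover have "scale (l - m) v \<in> eigenspace l a"
    using insert.prems subspace_eigenspace by (simp add: subspace_scale)
  ultimately have "scale (l - m) v = 0" using insert.IH insert.prems(1) by blast
  moreover have "l - m \<noteq> 0" using insert.prems(1) by auto
  ultimately show ?case by simp
qed

text \<open>
  A grading by the group of order two amounts to an automorphism whose square is trivial.
\<close>

lemma grading_involution: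
  assumes E: "subspace E" and D: "subspace D" and ED: "span (E \<union> D) = UNIV" "E \<inter> D \<subseteq> {0}"
    and EE: "\<And>x y. x \<in> E \<Longrightarrow> y \<in> E \<Longrightarrow> mul x y \<in> E"
    and ED': "\<And>x y. x \<in> E \<Longrightarrow> y \<in> D \<Longrightarrow> mul x y \<in> D"
    and DD: "\<And>x y. x \<in> D \<Longrightarrow> y \<in> D \<Longrightarrow> mul x y \<in> E"
  shows "\<exists>t. algebra_automorphism t \<and> (\<forall>v\<in>E. t v = v) \<and> (\<forall>v\<in>D. t v = - v) \<and> (\<forall>v. t (t v) = v)"
proof -
  have dec: "\<exists>x\<in>E. \<exists>y\<in>D. v = x + y" for v
  proof -
    have "v \<in> span (E \<union> D)" using ED(1) by simp
    then show ?thesis using E D unfolding span_Un by (auto simp: span_eq_iff[THEN iffD2])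
  qed
  have uniq: "x = x' \<and> y = y'" if "x \<in> E" "y \<in> D" "x' \<in> E" "y' \<in> D" "x + y = x' + y'" for x y x' y'
  proof -
    have "x - x' = y' - y" using that(5) by (simp add: algebra_simps)
    moreover have "x - x' \<in> E" "y' - y \<in> D" using that E D by (simp_all add: subspace_diff)
    ultimately have "x - x' = 0" using ED(2) by auto
    with \<open>x - x' = y' - y\<close> show ?thesis by simp
  qed
  have "\<forall>v. \<exists>w. \<exists>x\<in>E. \<exists>y\<in>D. v = x + y \<and> w = x - y" using dec by metis
  then obtain t where t: "\<And>v. \<exists>x\<in>E. \<exists>y\<in>D. v = x + y \<and> t v = x - y" by metis
  have tI: "t (x + y) = x - y" if "x \<in> E" "y \<in> D" for x y
    using t[of "x + y"] uniq that by metis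
  have 0: "0 \<in> E" "0 \<in> D" using E D by (simp_all add: subspace_0)
  have invol: "t (t v) = v" for v
  proof -
    obtain x y where "x \<in> E" "y \<in> D" "v = x + y" using dec by blast
    then show ?thesis using tI[of x y] tI[of x "- y"] subspace_neg[OF D] by simp
  qed
  have add: "t (v + w) = t v + t w" for v w
  proof -
    obtain x y x' y' where *: "x \<in> E" "y \<in> D" "v = x + y" "x' \<in> E" "y' \<in> D" "w = x' + y'"
      using dec by meson
    then have "t ((x + x') + (y + y')) = (x + x') - (y + y')"
      using E D by (intro tI) (auto simp: subspace_add)
    moreover have "(x + x') + (y + y') = v + w" using * by (simp add: algebra_simps)
    moreover have "(x + x') - (y + y') = t v + t w"
      using * tI[of x y] tI[of x' y'] by simp
    ultimately show ?thesis by simp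
  qed
  have scl: "t (scale c v) = scale c (t v)" for c v
  proof -
    obtain x y where *: "x \<in> E" "y \<in> D" "v = x + y" using dec by blast
    then have "t (scale c x + scale c y) = scale c x - scale c y"
      using E D by (intro tI) (auto simp: subspace_scale)
    then show ?thesis using * tI by (simp add: scale_right_distrib scale_right_diff_distrib)
  qed
  have mult: "t (mul v w) = mul (t v) (t w)" for v w
  proof -
    obtain x y x' y' where *: "x \<in> E" "y \<in> D" "v = x + y" "x' \<in> E" "y' \<in> D" "w = x' + y'"
      using dec by meson
    then have "t ((mul x x' + mul y y') + (mul x y' + mul y x')) = (mul x x' + mul y y') - (mul x y' + mul y x')"
      using E D EE ED' DD mul_commute[of y x'] by (intro tI) (auto simp: subspace_add)
    moreover have "(mul x x' + mul y y') + (mul x y' + mul y x') = mul v w"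
      using * by (simp add: mul_simps algebra_simps)
    moreover have "(mul x x' + mul y y') - (mul x y' + mul y x') = mul (t v) (t w)"
      using * tI[of x y] tI[of x' y'] by (simp add: mul_simps)
    ultimately show ?thesis by simp
  qed
  have "bij t" using invol by (metis bijI' )
  then have "algebra_automorphism t"
    unfolding algebra_automorphism_def Vector_Spaces.linear_iff using add scl mult vector_space_axioms by blast
  moreover have "\<forall>v\<in>E. t v = v" "\<forall>v\<in>D. t v = - v"
    using tI[of _ 0] tI[of 0] 0 by simp_all
  ultimately show ?thesis using invol by blast
qed

text \<open>
  The space usually written \<open>A\<^sub>P(a) = \<Oplus>\<^bsub>n\<in>P\<^esub> A\<^sub>n(a)\<close>.
\<close>

definition eigensum :: "monster_ev set \<Rightarrow> 'a \<Rightarrow> 'a set" where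
  "eigensum P a = span (\<Union>n\<in>P. eigenspace (ev_val n) a)"

lemma subspace_eigensum: "subspace (eigensum P a)"
  by (simp add: eigensum_def)

lemma eigensum_singleton: "eigensum {l} a = eigenspace (ev_val l) a"
  unfolding eigensum_def using subspace_eigenspace by (simp add: span_eq_iff[THEN iffD2])

lemma eigensum_base: "v \<in> eigenspace (ev_val l) a \<Longrightarrow> l \<in> P \<Longrightarrow> v \<in> eigensum P a"
  unfolding eigensum_def by (blast intro: span_base)

lemma eigensum_mono: "P \<subseteq> Q \<Longrightarrow> eigensum P a \<subseteq> eigensum Q a"
  unfolding eigensum_def by (intro span_mono UN_mono) simp_all

lemma eigensum_Un: "eigensum (P \<union> Q) a = span (eigensum P a \<union> eigensum Q a)"
  unfolding eigensum_def span_Un span_span image_Un Union_Un_distrib ..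

lemma eigensum_mul:
  assumes "monster_axis a" "x \<in> eigensum P a" "y \<in> eigensum Q a"
    and "\<And>l m. l \<in> P \<Longrightarrow> m \<in> Q \<Longrightarrow> monster_fusion l m \<subseteq> R"
  shows "mul x y \<in> eigensum R a"
proof (rule mul_span[OF assms(2,3)[unfolded eigensum_def] subspace_eigensum])
  fix x y
  assume "x \<in> (\<Union>l\<in>P. eigenspace (ev_val l) a)" "y \<in> (\<Union>m\<in>Q. eigenspace (ev_val m) a)"
  then obtain l m where lm: "l \<in> P" "m \<in> Q" "x \<in> eigenspace (ev_val l) a" "y \<in> eigenspace (ev_val m) a"
    by blast
  then have "mul x y \<in> span (\<Union>n \<in> monster_fusion l m. eigenspace (ev_val n) a)"
    using assms(1) unfolding monster_axis_def by blast
  also have "\<dots> \<subseteq> eigensum R a"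
    unfolding eigensum_def using assms(4)[OF lm(1,2)] by (intro span_mono) blast
  finally show "mul x y \<in> eigensum R a" .
qed

lemma eigensum_all:
  assumes "monster_axis a"
  shows "eigensum UNIV a = UNIV"
proof -
  have "(\<Union>l. eigenspace l a) \<subseteq> eigensum UNIV a"
  proof clarify
    fix l v assume v: "v \<in> eigenspace l a"
    show "v \<in> eigensum UNIV a"
    proof (cases "eigenspace l a = {0}")
      case True then show ?thesis using v subspace_eigensum subspace_0 by auto
    next
      case False
      then obtain n where "l = ev_val n" using assms unfolding monster_axis_def by auto
      then show ?thesis using v eigensum_base by blast
    qed
  qed
  then have "span (\<Union>l. eigenspace l a) \<subseteq> eigensum UNIV a"
    by (simp add: span_minimal subspace_eigensum)
  then show ?thesis using assms unfolding monster_axis_def by auto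
qed

lemma eigensum_Int:
  assumes "v \<in> eigensum P a" "v \<in> eigensum {l} a" "l \<notin> P"
  shows "v = 0"
proof (rule eigenspace_span_Int)
  show "v \<in> eigenspace (ev_val l) a" using assms(2) by (simp add: eigensum_singleton)
  show "v \<in> span (\<Union>m\<in>ev_val ` P. eigenspace m a)" using assms(1) by (simp add: eigensum_def image_image)
  have "finite (UNIV :: monster_ev set)"
  proof -
    have "(UNIV :: monster_ev set) = {Ev1, Ev0, Ev4, Ev32}" using monster_ev.exhaust by blast
    then show ?thesis by (metis finite.simps)
  qed
  then show "finite (ev_val ` P :: 'f set)" by (meson finite_imageI finite_subset subset_UNIV)
  show "(ev_val l :: 'f) \<notin> ev_val ` P" using assms(3) by (auto simp: ev_val_inj)
qed

text \<open>
  The Monster fusion law makes \<open>Ev32\<close> the odd part of a grading. Once that eigenspace vanishes, \<open>Ev4\<close> is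
  the odd part of a second one. The hypotheses on \<open>P\<close> and \<open>l\<close> cover both situations.
\<close>

lemma axis_fusion_involution:
  assumes a: "monster_axis a" and U: "eigensum (insert l P) a = UNIV" and l: "l \<notin> P"
    and PP: "\<And>m n. m \<in> P \<Longrightarrow> n \<in> P \<Longrightarrow> monster_fusion m n \<subseteq> P"
    and Pl: "\<And>m. m \<in> P \<Longrightarrow> monster_fusion m l \<subseteq> {l}"
    and ll: "monster_fusion l l \<subseteq> P"
  obtains t where "algebra_automorphism t" "\<And>v. v \<in> eigensum P a \<Longrightarrow> t v = v"
    "\<And>v. v \<in> eigensum {l} a \<Longrightarrow> t v = - v" "\<And>v. t (t v) = v"
proof -
  have "\<exists>t. algebra_automorphism t \<and> (\<forall>v\<in>eigensum P a. t v = v) \<and> (\<forall>v\<in>eigensum {l} a. t v = - v)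
      \<and> (\<forall>v. t (t v) = v)"
  proof (rule grading_involution[OF subspace_eigensum subspace_eigensum])
    show "span (eigensum P a \<union> eigensum {l} a) = UNIV" using U by (simp flip: eigensum_Un)
    show "eigensum P a \<inter> eigensum {l} a \<subseteq> {0}" using eigensum_Int l by blast
    show "mul x y \<in> eigensum P a" if "x \<in> eigensum P a" "y \<in> eigensum P a" for x y
      using eigensum_mul[OF a that] PP by blast
    show "mul x y \<in> eigensum {l} a" if "x \<in> eigensum P a" "y \<in> eigensum {l} a" for x y
      using eigensum_mul[OF a that] Pl by blast
    show "mul x y \<in> eigensum P a" if "x \<in> eigensum {l} a" "y \<in> eigensum {l} a" for x y
      using eigensum_mul[OF a that] ll by blast
  qed
  then show ?thesis using that by blast
qed

section \<open>Automorphisms\<close>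

lemma automorphism_simps:
  assumes "algebra_automorphism g"
  shows "g (x + y) = g x + g y" "g (x - y) = g x - g y" "g (scale r x) = scale r (g x)"
    "g (- x) = - g x" "g 0 = 0" "g (mul x y) = mul (g x) (g y)" "g (sum h I) = (\<Sum>i\<in>I. g (h i))"
proof -
  interpret g: Vector_Spaces.linear scale scale g using assms by (simp add: algebra_automorphism_def)
  show "g (x + y) = g x + g y" "g (x - y) = g x - g y" "g (scale r x) = scale r (g x)"
    "g (- x) = - g x" "g 0 = 0" "g (sum h I) = (\<Sum>i\<in>I. g (h i))"
    by (simp_all add: g.add g.diff g.scale g.neg g.zero g.sum)
  show "g (mul x y) = mul (g x) (g y)" using assms by (simp add: algebra_automorphism_def)
qed

lemma automorphism_compose:
  "algebra_automorphism g \<Longrightarrow> algebra_automorphism h \<Longrightarrow> algebra_automorphism (g \<circ> h)"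
  unfolding algebra_automorphism_def Vector_Spaces.linear_iff by (auto simp: bij_comp)

lemma automorphism_funpow: "algebra_automorphism g \<Longrightarrow> algebra_automorphism (g ^^ k)"
proof (induction k)
  case 0
  then show ?case using vector_space_axioms
    by (simp add: algebra_automorphism_def Vector_Spaces.linear_iff bij_def)
next
  case (Suc k)
  then show ?case using automorphism_compose[of g "g ^^ k"] by (simp add: comp_def)
qed

lemma automorphism_eigenspace:
  assumes g: "algebra_automorphism g"
  shows "eigenspace l (g a) = g ` eigenspace l a"
proof -
  have bij: "bij g" using g by (simp add: algebra_automorphism_def)
  have "g v \<in> eigenspace l (g a) \<longleftrightarrow> v \<in> eigenspace l a" for v
    unfolding eigenspace_def using bij
    by (simp add: bij_def inj_eq flip: automorphism_simps[OF g])
  then show ?thesis using bij by (auto simp: bij_def image_iff) (metis surj_def)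
qed

lemma automorphism_span: "algebra_automorphism g \<Longrightarrow> span (g ` S) = g ` span S"
  unfolding algebra_automorphism_def
  by (metis module_hom.span_image module_hom_iff_linear)

lemma automorphism_eigensum: "algebra_automorphism g \<Longrightarrow> eigensum P (g a) = g ` eigensum P a"
  unfolding eigensum_def by (simp add: automorphism_eigenspace flip: image_UN automorphism_span)

lemma automorphism_axis:
  assumes g: "algebra_automorphism g" and a: "monster_axis a"
  shows "monster_axis (g a)"
proof -
  have inj: "inj g" and surj: "surj g" using g by (auto simp: algebra_automorphism_def bij_def)
  have g0: "g ` {0} = {0}" by (simp add: automorphism_simps[OF g])
  have "g a \<noteq> 0" using inj a automorphism_simps(5)[OF g] unfolding monster_axis_def by (metis injD)
  moreover have "mul (g a) (g a) = g a"
    using a by (simp add: monster_axis_def flip: automorphism_simps(6)[OF g])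
  moreover have "span (\<Union>l. eigenspace l (g a)) = UNIV"
    using a surj by (simp add: monster_axis_def automorphism_eigenspace[OF g] flip: image_UN)
      (simp add: automorphism_span[OF g])
  moreover have "l \<in> range ev_val" if "eigenspace l (g a) \<noteq> {0}" for l
    using a that g0 unfolding automorphism_eigenspace[OF g] monster_axis_def by metis
  moreover have "eigenspace 1 (g a) = span {g a}"
    using a automorphism_span[OF g, of "{a}"] by (simp add: monster_axis_def automorphism_eigenspace[OF g])
  moreover have "mul x y \<in> span (\<Union>n \<in> monster_fusion l m. eigenspace (ev_val n) (g a))"
    if xy: "x \<in> eigenspace (ev_val l) (g a)" "y \<in> eigenspace (ev_val m) (g a)" for l m x y
  proof -
    obtain u v where uv: "x = g u" "y = g v" "u \<in> eigenspace (ev_val l) a" "v \<in> eigenspace (ev_val m) a"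
      using xy unfolding automorphism_eigenspace[OF g] by blast
    then have "mul u v \<in> span (\<Union>n \<in> monster_fusion l m. eigenspace (ev_val n) a)"
      using a unfolding monster_axis_def by blast
    then show ?thesis
      using uv automorphism_eigensum[OF g, of "monster_fusion l m" a]
      by (auto simp: eigensum_def simp flip: automorphism_simps(6)[OF g])
  qed
  ultimately show ?thesis unfolding monster_axis_def by blast
qed

text \<open>
  An automorphism that fixes \<open>a\<close> preserves the eigenspaces of \<open>a\<close>, hence every map that they define.
\<close>

lemma automorphism_commutes:
  assumes g: "algebra_automorphism g" "g a = a"
    and \<sigma>: "algebra_automorphism \<sigma>" and U: "eigensum (insert l P) a = UNIV"
    and P: "\<And>v. v \<in> eigensum P a \<Longrightarrow> \<sigma> v = v" and l: "\<And>v. v \<in> eigensum {l} a \<Longrightarrow> \<sigma> v = - v"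
  shows "g (\<sigma> v) = \<sigma> (g v)"
proof -
  have "v \<in> span (eigensum P a \<union> eigensum {l} a)" using U by (simp flip: eigensum_Un)
  then obtain x y where xy: "v = x + y" "x \<in> eigensum P a" "y \<in> eigensum {l} a"
    unfolding span_Un by (auto simp: span_eq_iff[THEN iffD2] subspace_eigensum)
  then have "g x \<in> eigensum P a" "g y \<in> eigensum {l} a"
    using automorphism_eigensum[OF g(1), of _ a] g(2) by auto
  then show ?thesis
    using xy P l by (simp add: automorphism_simps[OF g(1)] automorphism_simps[OF \<sigma>])
qed

text \<open>
  The description that defines \<open>\<tau>\<^sub>b\<close> is met by exactly one map: one exists by the grading, and two such maps
  agree on the eigenspaces, which span the algebra.
\<close>

lemma miyamoto:
  assumes b: "monster_axis b"
  shows "algebra_automorphism (miyamoto b)"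
    and "v \<in> eigensum {Ev1, Ev0, Ev4} b \<Longrightarrow> miyamoto b v = v"
proof -
  let ?E = "eigensum {Ev1, Ev0, Ev4} b" and ?D = "eigensum {Ev32} b"
  let ?P = "\<lambda>t. algebra_automorphism t \<and>
     (\<forall>v \<in> span (eigenspace 1 b \<union> eigenspace 0 b \<union> eigenspace (1 / 4) b). t v = v) \<and>
     (\<forall>v \<in> eigenspace (1 / 32) b. t v = - v)"
  have E: "span (eigenspace 1 b \<union> eigenspace 0 b \<union> eigenspace (1 / 4) b) = ?E"
    by (simp add: eigensum_def Un_assoc)
  have D: "eigenspace (1 / 32) b = ?D" by (simp add: eigensum_singleton)
  have all: "{Ev32, Ev1, Ev0, Ev4} = UNIV" using monster_ev.exhaust by blast
  obtain t where t: "algebra_automorphism t" "\<And>v. v \<in> ?E \<Longrightarrow> t v = v" "\<And>v. v \<in> ?D \<Longrightarrow> t v = - v"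
    by (rule axis_fusion_involution[OF b, of Ev32 "{Ev1, Ev0, Ev4}"]) (use all eigensum_all[OF b] in auto)
  have "t' = t" if "?P t'" for t'
  proof
    fix v
    have "v \<in> span (?E \<union> ?D)"
      using eigensum_all[OF b] all eigensum_Un[of "{Ev1, Ev0, Ev4}" "{Ev32}" b] by (simp add: insert_commute)
    then obtain x y where "v = x + y" "x \<in> ?E" "y \<in> ?D"
      unfolding span_Un by (auto simp: span_eq_iff[THEN iffD2] subspace_eigensum)
    then show "t' v = t v" using that t by (simp add: E D automorphism_simps)
  qed
  moreover have "?P t" using t by (simp add: E D)
  ultimately have "\<exists>!t. ?P t" by blast
  from theI'[OF this] have "?P (miyamoto b)" unfolding miyamoto_def .
  then show "algebra_automorphism (miyamoto b)" "v \<in> ?E \<Longrightarrow> miyamoto b v = v"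
    by (simp_all add: E)
qed

section \<open>Axes in a 2A subalgebra\<close>

text \<open>
  The products of distinct basis elements of \<open>2A\<close>, where \<open>d\<close> stands for \<open>a\<^sub>\<rho>\<close>.
\<close>

definition norton_2A :: "'a \<Rightarrow> 'a \<Rightarrow> 'a \<Rightarrow> bool" where
  "norton_2A a b d \<longleftrightarrow> mul a b = scale (1 / 8) (a + b - d) \<and>
     mul a d = scale (1 / 8) (a + d - b) \<and> mul b d = scale (1 / 8) (b + d - a)"

lemma norton_2A_commute: "norton_2A a b d \<Longrightarrow> norton_2A b a d"
  unfolding norton_2A_def by (simp add: mul_commute add.commute)

lemma automorphism_norton_2A:
  assumes g: "algebra_automorphism g" and "norton_2A a b d"
  shows "norton_2A (g a) (g b) (g d)"
  using assms(2) unfolding norton_2A_def by (simp add: automorphism_simps[OF g] flip: automorphism_simps(6)[OF g])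

lemma norton_2A_eigenvectors:
  assumes a: "mul a a = a" and N: "norton_2A a b d"
  shows "b + d - scale (1 / 4) a \<in> eigensum {Ev0} a" and "b - d \<in> eigensum {Ev4} a"
proof -
  show "b + d - scale (1 / 4) a \<in> eigensum {Ev0} a"
    unfolding eigensum_singleton eigenspace_def using N
    by (auto simp: norton_2A_def a mul_simps intro!: eq_by_functionals)
       (simp add: functional_simps field_simps)
  show "b - d \<in> eigensum {Ev4} a"
    unfolding eigensum_singleton eigenspace_def using N
    by (auto simp: norton_2A_def a mul_simps intro!: eq_by_functionals)
       (simp add: functional_simps field_simps)
qed

text \<open>
  The axis \<open>b\<close> is \<open>a/8\<close> plus half of each of the two eigenvectors in \<open>norton_2A_eigenvectors\<close>, so \<open>\<tau>\<^sub>a\<close>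
  fixes it.
\<close>

lemma norton_2A_even:
  assumes a: "mul a a = a" and N: "norton_2A a b d"
  shows "b \<in> eigensum {Ev1, Ev0, Ev4} a"
proof -
  let ?E = "eigensum {Ev1, Ev0, Ev4} a"
  have sub: "eigensum {l} a \<subseteq> ?E" if "l \<in> {Ev1, Ev0, Ev4}" for l
    using that by (intro eigensum_mono) simp
  have "a \<in> eigensum {Ev1} a" by (simp add: eigensum_singleton eigenspace_def a)
  then have "scale (1 / 8) a + scale (1 / 2) (b + d - scale (1 / 4) a) + scale (1 / 2) (b - d) \<in> ?E"
    using norton_2A_eigenvectors[OF assms] sub
    by (intro subspace_add[OF subspace_eigensum] subspace_scale[OF subspace_eigensum]) auto
  also have "scale (1 / 8) a + scale (1 / 2) (b + d - scale (1 / 4) a) + scale (1 / 2) (b - d) = b"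
    by (rule eq_by_functionals) (simp add: functional_simps field_simps)
  finally show ?thesis .
qed

text \<open>
  The fixed space of \<open>\<tau>\<^sub>a\<close> is a subalgebra, so \<open>\<tau>\<^sub>a\<close> is trivial as soon as it fixes the generators.
\<close>

lemma even_eigensum_UNIV:
  assumes a: "monster_axis a" and gen: "gen_subalgebra X = UNIV"
    and X: "X \<subseteq> eigensum {Ev1, Ev0, Ev4} a"
  shows "eigensum {Ev1, Ev0, Ev4} a = UNIV"
proof -
  have "subalgebra (eigensum {Ev1, Ev0, Ev4} a)"
    unfolding subalgebra_def using subspace_eigensum eigensum_mul[OF a, of _ "{Ev1, Ev0, Ev4}" _ "{Ev1, Ev0, Ev4}"]
    by force
  then have "gen_subalgebra X \<subseteq> eigensum {Ev1, Ev0, Ev4} a"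
    unfolding gen_subalgebra_def using X by (simp add: hull_minimal)
  then show ?thesis using gen by blast
qed

section \<open>The collapse of an odd dihedral sequence\<close>

text \<open>
  Oddness of the period enters through a sign: the error \<open>r\<close> in \<open>s\<^bsub>i,i+j\<^esub> = (z\<^bsub>i+j\<^esub> - z\<^sub>i)/32\<close> is
  negated by \<open>i \<mapsto> i + j\<close>, so after \<open>n\<close> steps it is its own negative. The factor \<open>1/32\<close> comes from
  the eigenvalue of \<open>x\<^bsub>i+j\<^esub> - x\<^bsub>i-j\<^esub>\<close>, whereas fusion with the \<open>0\<close>-eigenvector \<open>u\<close> computes the sum over \<open>j\<close>
  with the factor \<open>1/8\<close>.
\<close>

lemma odd_dihedral_collapse:
  fixes x :: "int \<Rightarrow> 'a" and n :: nat
  assumes \<sigma>: "algebra_automorphism \<sigma>" "\<And>v. \<sigma> (\<sigma> v) = v"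
    and axis: "\<And>i. monster_axis (x i)"
    and N: "\<And>i. norton_2A a (x i) (\<sigma> (x i))"
    and n: "odd n" and per: "\<And>i. x (i + int n) = x i"
    and refl: "\<And>i j. mul (x i) (x (i + j) - x (i - j)) = scale (1 / 32) (x (i + j) - x (i - j))"
    and sum: "\<And>i. mul (x i) (\<Sum>j<n. x (i + int j)) = scale \<nu> (x i)"
  shows "x 0 = x 1"
proof -
  note \<sigma>_simps = automorphism_simps[OF \<sigma>(1)]
  have idem: "mul (x i) (x i) = x i" for i using axis by (simp add: monster_axis_def)
  define z where "z i = x i - \<sigma> (x i)" for i
  define s where "s i k = mul (\<sigma> (x i)) (x k) - mul (x i) (\<sigma> (x k))" for i k
  have anti: "s k i = - s i k" for i k
    by (simp add: s_def mul_commute)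
  have s_refl: "s i (i + j) - s i (i - j) = scale (1 / 32) (z (i + j) - z (i - j))" for i j
  proof -
    define v where "v = x (i + j) - x (i - j)"
    have v: "v \<in> eigensum {Ev32} (x i)" using refl by (simp add: v_def eigensum_singleton eigenspace_def)
    have "a \<in> eigensum {Ev1, Ev0, Ev4} (x i)"
      using norton_2A_even[OF idem norton_2A_commute[OF N]] .
    then have av: "mul a v \<in> eigensum {Ev32} (x i)"
      using v by (rule eigensum_mul[OF axis]) auto
    \<comment> \<open>Both \<open>v\<close> and \<open>a v\<close> are odd for \<open>x\<^sub>i\<close>, and \<open>\<sigma> v\<close> is a combination of them.\<close>
    have "\<sigma> v = v - scale 8 (mul a v)"
      using N unfolding v_def
      by (auto simp: mul_simps \<sigma>_simps norton_2A_def intro!: eq_by_functionals)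
         (simp add: functional_simps field_simps)
    then have "\<sigma> v \<in> eigensum {Ev32} (x i)"
      using v av by (simp add: subspace_eigensum subspace_diff subspace_scale)
    then have 1: "mul (x i) (\<sigma> v) = scale (1 / 32) (\<sigma> v)"
      by (simp add: eigensum_singleton eigenspace_def)
    then have "mul (\<sigma> (x i)) v = scale (1 / 32) v"
      using \<sigma>_simps(6)[of "x i" "\<sigma> v"] by (simp add: \<sigma> \<sigma>_simps(3))
    then have "mul (\<sigma> (x i)) v - mul (x i) (\<sigma> v) = scale (1 / 32) (v - \<sigma> v)"
      using 1 by (simp add: scale_right_diff_distrib)
    then show ?thesis by (simp add: v_def z_def s_def mul_simps \<sigma>_simps algebra_simps)
  qed
  have s_eq: "s i (i + int j) = scale (1 / 32) (z (i + int j) - z i)" for i j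
  proof -
    define r where "r i = s i (i + int j) - scale (1 / 32) (z (i + int j) - z i)" for i
    have "r (i + int j) = - r i" for i
      using s_refl[of "i + int j" "int j"] anti[of i "i + int j"]
      by (simp add: r_def algebra_simps)
    note step = this
    have "r (i + int (k * j)) = (if even k then r i else - r i)" for k
    proof (induction k)
      case (Suc k)
      then show ?case using step[of "i + int (k * j)"] by (simp add: algebra_simps)
    qed simp
    note r_iter = this
    have per': "x (i + int (n * m)) = x i" for i m
    proof (induction m)
      case (Suc m)
      then show ?case using per[of "i + int (n * m)"] by (simp add: algebra_simps)
    qed simp
    have "r (i + int (n * j)) = r i"
      using per'[of i j] per'[of "i + int j" j] by (simp add: r_def s_def z_def algebra_simps)
    with r_iter[of n] n have "r i = - r i" by simp
    then have "scale 2 (r i) = 0"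
      using scale_left_distrib[of 1 1 "r i"] by (simp add: eq_neg_iff_add_eq_0)
    then have "r i = 0" by simp
    then show ?thesis by (simp add: r_def)
  qed
  define S where "S i = (\<Sum>j<n. x (i + int j))" for i
  have S_const: "S i = S 0" for i
  proof -
    have "S (k + 1) = S k" for k
    proof -
      have "S k + x (k + int n) = (\<Sum>j<Suc n. x (k + int j))" by (simp add: S_def)
      also have "\<dots> = x k + S (k + 1)"
        unfolding S_def sum.lessThan_Suc_shift by (simp add: algebra_simps)
      finally show ?thesis by (simp add: per)
    qed
    from this this[of "k - 1" for k] show ?thesis
      by (induction i rule: int_induct[of _ 0]) auto
  qed
  have nz: "scale (of_nat n) (z i) = S i - \<sigma> (S i)" for i
  proof -
    define b d u where "b = x i" and "d = \<sigma> b" and "u = S i - scale \<nu> b"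
    have bd: "mul a b = scale (1 / 8) (a + b - d)" "mul b d = scale (1 / 8) (b + d - a)"
      "mul b b = b"
      using N[of i] idem[of i] by (simp_all add: norton_2A_def b_def d_def)
    have ba: "mul b a = scale (1 / 8) (a + b - d)" using bd(1) by (simp add: mul_commute)
    have bS: "mul b (S i) = scale \<nu> b" using sum by (simp add: S_def b_def)
    have aS: "mul a (S i) = scale (1 / 8) (scale (of_nat n) a + S i - \<sigma> (S i))"
      unfolding S_def mul_sum_right \<sigma>_simps(7)
      using N by (simp add: norton_2A_def sum.distrib sum_subtractf sum_constant_scale flip: scale_sum_right)
    have u: "u \<in> eigensum {Ev0} (x i)"
      using bS bd(3) by (simp add: eigensum_singleton eigenspace_def u_def b_def mul_simps)
    have "a + d - scale (1 / 4) b \<in> eigensum {Ev0} b" "a - d \<in> eigensum {Ev4} b"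
      using norton_2A_eigenvectors[OF _ norton_2A_commute[OF N]] idem by (auto simp: b_def d_def)
    then have "mul u (a + d - scale (1 / 4) b) \<in> eigensum {Ev0} b" "mul u (a - d) \<in> eigensum {Ev4} b"
      using u axis eigensum_mul[of b u "{Ev0}" _ "{Ev0}" "{Ev0}"] eigensum_mul[of b u "{Ev0}" _ "{Ev4}" "{Ev4}"]
      by (auto simp: b_def)
    then have 1: "mul b (mul u (a + d - scale (1 / 4) b)) = 0"
      and 2: "mul b (mul u (a - d)) = scale (1 / 4) (mul u (a - d))"
      by (simp_all add: eigensum_singleton eigenspace_def)
    have ub: "mul u b = 0" "mul b u = 0"
      using u by (simp_all add: eigensum_singleton eigenspace_def b_def mul_commute)
    \<comment> \<open>With \<open>p = a + d - b/4\<close> and \<open>q = a - d\<close>: \<open>up + uq = 2 ua\<close> and \<open>b(up) = 0\<close>, so \<open>8 b(ua) = uq\<close>.\<close>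
    have ud: "mul u d = mul u a - scale 8 (mul b (mul u a))"
    proof (rule eq_by_functionals)
      fix f assume f: "Vector_Spaces.linear scale (*) f"
      show "f (mul u d) = f (mul u a - scale 8 (mul b (mul u a)))"
        using arg_cong[OF 1, of f] arg_cong[OF 2, of f]
        by (simp add: mul_simps ub functional_simps[OF f] field_simps) algebra
    qed
    have "mul d (S i) - mul b (\<sigma> (S i)) = scale (1 / 8) (S i - \<sigma> (S i) - scale (of_nat n) (b - d))"
    proof (rule eq_by_functionals)
      fix f assume f: "Vector_Spaces.linear scale (*) f"
      have "mul u a = mul a (S i) - scale \<nu> (mul a b)"
        "mul u d = mul d (S i) - scale \<nu> (mul b d)"
        by (simp_all add: u_def mul_simps mul_commute)
      then have "f (mul d (S i) - scale \<nu> (mul b d))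
          = f (mul a (S i) - scale \<nu> (mul a b) - scale 8 (mul b (mul a (S i) - scale \<nu> (mul a b))))"
        using ud by simp
      then show "f (mul d (S i) - mul b (\<sigma> (S i))) = f (scale (1 / 8) (S i - \<sigma> (S i) - scale (of_nat n) (b - d)))"
        by (simp add: aS bS bd ba mul_simps functional_simps[OF f] field_simps)
          (rule mult_left_cancel[THEN iffD1, of 64], simp, algebra)
    qed
    moreover have "mul d (S i) - mul b (\<sigma> (S i)) = scale (1 / 32) (S i - \<sigma> (S i) - scale (of_nat n) (b - d))"
    proof -
      have "mul d (S i) - mul b (\<sigma> (S i)) = (\<Sum>j<n. s i (i + int j))"
        by (simp add: S_def s_def b_def d_def mul_sum_right \<sigma>_simps(7) sum_subtractf)
      also have "\<dots> = scale (1 / 32) (\<Sum>j<n. z (i + int j) - z i)"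
        by (simp add: s_eq scale_sum_right)
      also have "(\<Sum>j<n. z (i + int j) - z i) = S i - \<sigma> (S i) - scale (of_nat n) (b - d)"
        by (simp add: z_def S_def sum_subtractf \<sigma>_simps(7) sum_constant_scale b_def d_def
            scale_right_diff_distrib)
      finally show ?thesis .
    qed
    ultimately have "scale (1 / 8) (S i - \<sigma> (S i) - scale (of_nat n) (b - d))
        = scale (1 / 32) (S i - \<sigma> (S i) - scale (of_nat n) (b - d))" by simp
    then have "S i - \<sigma> (S i) - scale (of_nat n) (b - d) = 0"
      by (subst (asm) scale_cancel_right) simp
    then show ?thesis by (simp add: z_def b_def d_def)
  qed
  \<comment> \<open>The sum \<open>S\<close> is the same for every starting index, so all \<open>z i\<close> agree.\<close>
  have "scale (of_nat n) (z 0) = scale (of_nat n) (z 1)"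
    unfolding nz by (simp add: S_const[of 1])
  moreover have "(of_nat n :: 'f) \<noteq> 0" using n by (metis even_zero of_nat_eq_0_iff)
  ultimately have z: "z 0 = z 1" by (simp add: scale_cancel_left)
  then have "s 0 1 = 0" using s_eq[of 0 1] by simp
  then have "mul (x 0) (z 1) = mul (x 1) (z 0)"
    by (simp add: s_def z_def mul_simps mul_commute)
  then have "mul (x 0) (z 0) = mul (x 1) (z 1)" using z by simp
  moreover have "mul (x i) (z i) = scale (1 / 8) (scale 6 (x i) + z i + a)" for i
    using N[of i] unfolding z_def norton_2A_def
    by (auto simp: mul_simps idem intro!: eq_by_functionals) (simp add: functional_simps field_simps)
  ultimately have "scale (1 / 8) (scale 6 (x 0) + z 1 + a) = scale (1 / 8) (scale 6 (x 1) + z 1 + a)"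
    using z by metis
  then show ?thesis by simp
qed

section \<open>Exclusion of the shapes\<close>

text \<open>
  It remains to produce \<open>\<sigma>\<close> and to transport axes and \<open>2A\<close> relations from \<open>b\<close> and \<open>c\<close> to the whole
  sequence. The power of \<open>\<rho>\<close> that does this commutes with \<open>\<sigma>\<close>, since it fixes \<open>a\<close>.
\<close>

lemma no_odd_dihedral:
  fixes n :: nat
  assumes gen: "gen_subalgebra {a, b, c} = UNIV"
    and axes: "monster_axis a" "monster_axis b" "monster_axis c"
    and ab: "norton_2A a b d" and ac: "norton_2A a c e"
    and n: "odd n" and per: "\<And>i. dihedral_seq b c (i + int n) = dihedral_seq b c i"
    and refl: "\<And>i j. mul (dihedral_seq b c i) (dihedral_seq b c (i + j) - dihedral_seq b c (i - j))
      = scale (1 / 32) (dihedral_seq b c (i + j) - dihedral_seq b c (i - j))"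
    and sum: "\<And>i. mul (dihedral_seq b c i) (\<Sum>j<n. dihedral_seq b c (i + int j))
      = scale \<nu> (dihedral_seq b c i)"
  shows "b = c"
proof -
  have idem: "mul a a = a" "mul b b = b" "mul c c = c" using axes by (simp_all add: monster_axis_def)
  have aa: "a \<in> eigensum {Ev1} a" by (simp add: eigensum_singleton eigenspace_def idem)
  have U: "eigensum {Ev1, Ev0, Ev4} a = UNIV"
  proof (rule even_eigensum_UNIV[OF axes(1) gen])
    have "eigensum {Ev1} a \<subseteq> eigensum {Ev1, Ev0, Ev4} a" by (rule eigensum_mono) simp
    then show "{a, b, c} \<subseteq> eigensum {Ev1, Ev0, Ev4} a"
      using aa norton_2A_even[OF idem(1)] ab ac by blast
  qed
  then have U': "eigensum {Ev4, Ev1, Ev0} a = UNIV" by (simp add: insert_commute)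
  obtain \<sigma> where \<sigma>: "algebra_automorphism \<sigma>" "\<And>v. v \<in> eigensum {Ev1, Ev0} a \<Longrightarrow> \<sigma> v = v"
    "\<And>v. v \<in> eigensum {Ev4} a \<Longrightarrow> \<sigma> v = - v" "\<And>v. \<sigma> (\<sigma> v) = v"
    by (rule axis_fusion_involution[OF axes(1) U']) auto
  \<comment> \<open>\<open>x + y - a/4\<close> is fixed and \<open>x - y\<close> negated, so \<open>\<sigma>\<close> exchanges \<open>x\<close> and \<open>y\<close>.\<close>
  have flip: "\<sigma> x = y" if N: "norton_2A a x y" for x y
  proof -
    note ev = norton_2A_eigenvectors[OF idem(1) N]
    have "x + y - scale (1 / 4) a \<in> eigensum {Ev1, Ev0} a" "a \<in> eigensum {Ev1, Ev0} a"
      using ev(1) aa eigensum_mono[of "{Ev0}" "{Ev1, Ev0}" a] eigensum_mono[of "{Ev1}" "{Ev1, Ev0}" a] by auto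
    then have 1: "\<sigma> (x + y - scale (1 / 4) a) = x + y - scale (1 / 4) a" "\<sigma> a = a"
      and 2: "\<sigma> (x - y) = - (x - y)"
      using \<sigma>(2,3) ev(2) by blast+
    show ?thesis
    proof (rule eq_by_functionals)
      fix f assume f: "Vector_Spaces.linear scale (*) f"
      show "f (\<sigma> x) = f y"
        using arg_cong[OF 1(1), of f] arg_cong[OF 2, of f]
        by (simp add: automorphism_simps[OF \<sigma>(1)] functional_simps[OF f] 1(2)) algebra
    qed
  qed
  define g where "g = rho b c"
  have a_even: "a \<in> eigensum {Ev1, Ev0, Ev4} b" "a \<in> eigensum {Ev1, Ev0, Ev4} c"
    using norton_2A_even idem norton_2A_commute ab ac by blast+
  have g: "algebra_automorphism g" "g a = a"
    using a_even miyamoto axes automorphism_compose by (auto simp: g_def rho_def)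
  have gk: "algebra_automorphism (g ^^ k)" "(g ^^ k) a = a" for k
    using automorphism_funpow[OF g(1)] by (auto, induction k) (auto simp: g)
  \<comment> \<open>By periodicity the index may be taken to be nonnegative, which avoids inverses of \<open>\<rho>\<close>.\<close>
  have orbit: "\<exists>k. dihedral_seq b c i = (g ^^ k) b \<or> dihedral_seq b c i = (g ^^ k) c" for i
  proof -
    have "dihedral_seq b c (i + int (n * m)) = dihedral_seq b c i" for m
    proof (induction m)
      case (Suc m)
      then show ?case using per[of "i + int (n * m)"] by (simp add: algebra_simps)
    qed simp
    moreover have "0 \<le> i + int (n * nat \<bar>i\<bar>)"
    proof -
      have "int 1 * \<bar>i\<bar> \<le> int n * \<bar>i\<bar>" using n by (intro mult_right_mono) (auto elim: oddE)
      then show ?thesis by simp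
    qed
    ultimately obtain k where "0 \<le> k" "dihedral_seq b c i = dihedral_seq b c k" by metis
    then show ?thesis unfolding dihedral_seq_def g_def Let_def by auto
  qed
  have "dihedral_seq b c 0 = dihedral_seq b c 1"
  proof (rule odd_dihedral_collapse[OF \<sigma>(1,4) _ _ n per refl sum])
    fix i
    obtain k y where y: "y = b \<or> y = c" "dihedral_seq b c i = (g ^^ k) y" using orbit by metis
    then show "monster_axis (dihedral_seq b c i)"
      using axes automorphism_axis[OF gk(1)] by auto
    have "norton_2A a y (\<sigma> y)" using y(1) flip ab ac by auto
    then have "norton_2A ((g ^^ k) a) ((g ^^ k) y) ((g ^^ k) (\<sigma> y))" by (rule automorphism_norton_2A[OF gk(1)])
    then show "norton_2A a (dihedral_seq b c i) (\<sigma> (dihedral_seq b c i))"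
      using y(2) gk(2)[of k] automorphism_commutes[OF gk \<sigma>(1) U' \<sigma>(2,3), of k y] by simp
  qed
  then show ?thesis by (simp add: dihedral_seq_def)
qed

lemma sakuma_iso_mul:
  assumes "sakuma_iso t ix p q"
  obtains \<phi> where "Vector_Spaces.linear (*s) scale \<phi>" "inj \<phi>"
    "\<And>i j. \<phi> (t i j) = mul (\<phi> (bvec i)) (\<phi> (bvec j))"
    "\<phi> (bvec (ix 0)) = p" "\<phi> (bvec (ix 1)) = q" "\<And>i. \<phi> (bvec (ix i)) = dihedral_seq p q i"
  using assms unfolding sakuma_iso_def bij_betw_def by (metis table_mul_bvec)

lemma iso_2A_norton:
  assumes "iso_2A a b"
  obtains d where "norton_2A a b d"
proof -
  obtain \<phi> :: "'f ^ 3 \<Rightarrow> 'a" where \<phi>: "Vector_Spaces.linear (*s) scale \<phi>"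
    "\<And>i j. \<phi> (table_2A i j) = mul (\<phi> (bvec i)) (\<phi> (bvec j))"
    "\<phi> (bvec 0) = a" "\<phi> (bvec 1) = b"
    using assms unfolding iso_2A_def by (elim sakuma_iso_mul) auto
  interpret \<phi>: Vector_Spaces.linear "(*s)" scale \<phi> by fact
  have "UNIV - {0, 1} = {2 :: 3}" "UNIV - {0, 2} = {1 :: 3}" "UNIV - {1, 2} = {0 :: 3}"
    using all_3[of "\<lambda>i. i = 0 \<or> i = 1 \<or> i = 2"] by auto
  then have "norton_2A a b (\<phi> (bvec 2))"
    unfolding norton_2A_def \<phi>(3,4)[symmetric] \<phi>(2)[symmetric] table_2A_def
    by (simp add: \<phi>.scale \<phi>.add \<phi>.diff)
  then show thesis by (rule that)
qed

text \<open>
  The isomorphism carries the identities of the table to the sequence \<open>x\<^sub>i\<close>; as it is injective, the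
  collapse \<open>b = c\<close> contradicts the independence of basis vectors.
\<close>

lemma no_odd_sakuma:
  fixes n :: nat and t :: "'i::finite \<Rightarrow> 'i \<Rightarrow> 'f ^ 'i"
  assumes gen: "gen_subalgebra {a, b, c} = UNIV"
    and axes: "monster_axis a" "monster_axis b" "monster_axis c"
    and iso: "iso_2A a b" "iso_2A a c" "sakuma_iso t ix b c"
    and n: "odd n" and per: "\<And>i. ix (i + int n) = ix i" and neq: "ix 0 \<noteq> ix 1"
    and refl: "\<And>i j. t (ix i) (ix (i + j)) - t (ix i) (ix (i - j))
      = (1 / 32) *s (bvec (ix (i + j)) - bvec (ix (i - j)))"
    and sum: "\<And>i. (\<Sum>j<n. t (ix i) (ix (i + int j))) = \<nu> *s bvec (ix i)"
  shows False
proof -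
  obtain \<phi> where \<phi>: "Vector_Spaces.linear (*s) scale \<phi>" "inj \<phi>"
    "\<And>i j. \<phi> (t i j) = mul (\<phi> (bvec i)) (\<phi> (bvec j))"
    "\<phi> (bvec (ix 0)) = b" "\<phi> (bvec (ix 1)) = c" "\<And>i. \<phi> (bvec (ix i)) = dihedral_seq b c i"
    by (rule sakuma_iso_mul[OF iso(3)]) blast
  interpret \<phi>: Vector_Spaces.linear "(*s)" scale \<phi> by fact
  obtain d e where "norton_2A a b d" "norton_2A a c e" using iso(1,2) iso_2A_norton by metis
  then have "b = c"
  proof (rule no_odd_dihedral[OF gen axes _ _ n])
    show "dihedral_seq b c (i + int n) = dihedral_seq b c i" for i
      using per by (simp flip: \<phi>(6))
    show "mul (dihedral_seq b c i) (dihedral_seq b c (i + j) - dihedral_seq b c (i - j))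
      = scale (1 / 32) (dihedral_seq b c (i + j) - dihedral_seq b c (i - j))" for i j
      using arg_cong[OF refl[of i j], of \<phi>]
      by (simp add: mul_diff_right \<phi>.diff \<phi>.scale \<phi>(3) flip: \<phi>(6))
    show "mul (dihedral_seq b c i) (\<Sum>j<n. dihedral_seq b c (i + int j)) = scale \<nu> (dihedral_seq b c i)" for i
      using arg_cong[OF sum[of i], of \<phi>]
      by (simp add: mul_sum_right \<phi>.sum \<phi>.scale \<phi>(3) flip: \<phi>(6))
  qed
  then have "bvec (ix 0) = (bvec (ix 1) :: 'f ^ 'i)" using \<phi>(2,4,5) by (metis injD)
  then show False using neq by (simp add: axis_eq_axis)
qed

end

theorem corollary5p3:
  fixes scale :: "'f::field_char_0 \<Rightarrow> 'a::ab_group_add \<Rightarrow> 'a"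
    and mul :: "'a \<Rightarrow> 'a \<Rightarrow> 'a"
  shows "\<not> (\<exists>a b c. monster_axial_algebra scale mul {a, b, c} \<and>
      comm_nonassoc_algebra.iso_2A scale mul a b \<and>
      comm_nonassoc_algebra.iso_2A scale mul a c \<and>
      (comm_nonassoc_algebra.iso_3C scale mul b c \<or>
       comm_nonassoc_algebra.iso_5A scale mul b c))"
proof clarify
  fix a b c
  assume "monster_axial_algebra scale mul {a, b, c}"
  then interpret monster_axial_algebra scale mul "{a, b, c}" .
  assume iso: "iso_2A a b" "iso_2A a c" "iso_3C b c \<or> iso_5A b c"
  note no = no_odd_sakuma[OF generated axes axes axes iso(1,2)]
  from iso(3) show False
  proof
    assume "iso_3C b c"
    then have 3: "sakuma_iso table_3C of_int b c" by (simp add: iso_3C_def)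
    show False
    proof (rule no[OF _ _ _ 3, of 3])
      show "(\<Sum>j<3. table_3C (of_int i) (of_int (i + int j))) = (33 / 32 :: 'f) *s bvec (of_int i)" for i
        using table_3C_sum[rule_format, of "of_int i"] by (simp add: eval_nat_numeral)
    qed (simp_all add: table_3C_reflection)
  next
    assume "iso_5A b c"
    then have 5: "sakuma_iso table_5A (\<lambda>i. Some (of_int i)) b c" by (simp add: iso_5A_def)
    show False
    proof (rule no[OF _ _ _ 5, of 5])
      show "(\<Sum>j<5. table_5A (Some (of_int i)) (Some (of_int (i + int j)))) = (35 / 32 :: 'f) *s a5 (of_int i)" for i
        using table_5A_sum[rule_format, of "of_int i"] by (simp add: eval_nat_numeral del: table_5A.simps)
    qed (simp_all add: table_5A_reflection del: table_5A.simps)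
  qed
qed

end
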